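(* For any positive integer $k$, the number of $n$-color compositions of $k$ in which no part has color $2$ is equal to the number of EVEN colored compositions of $k$.
   Context: A composition of a positive integer $k$ is a finite ordered sequence of positive integers (called parts) whose sum is $k$; positions of parts are numbered $1,2,3,\dots$ from left to right. An $n$-color composition (also called colored composition) of $k$ is a composition of $k$ in which every part of size $p$ is given one of $p$ colors $1,2,\dots,p$; a part of size $p$ with color $c$ is written $p_c$. Two $n$-color compositions are the same only if both the part sizes and the colors agree in order. An EVEN colored composition of $k$ is a composition of $k$ in which each part in an even position (2nd, 4th, ...) of size $p$ is given one of the colors $1,\dots,p$, while the parts in odd positions are not colored. "Restricting the color 2" means that no part is assigned the color $2$. *)

theory Defs
  imports Main
begin

definition compositions :: "nat \<Rightarrow> nat list set" where
  "compositions k = {ps. (\<forall>p \<in> set ps. 1 \<le> p) \<and> sum_list ps = k}"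

text \<open>A coloured part \<open>p\<^sub>c\<close> is the pair \<open>(p, c)\<close>.\<close>

definition n_color_compositions :: "nat \<Rightarrow> (nat \<times> nat) list set" where
  "n_color_compositions k =
     {xs. map fst xs \<in> compositions k \<and> (\<forall>(p, c) \<in> set xs. 1 \<le> c \<and> c \<le> p)}"

text \<open>
  Here a part is a pair \<open>(p, None)\<close> if it is not coloured, and \<open>(p, Some c)\<close> if it
  has colour \<open>c\<close>. Positions are numbered from 1, so the list entry at index \<open>i\<close> is the part
  in position \<open>i + 1\<close>.
\<close>

definition even_colored_compositions :: "nat \<Rightarrow> (nat \<times> nat option) list set" where
  "even_colored_compositions k =
     {xs. map fst xs \<in> compositions k \<and>
          (\<forall>i < length xs.
             if even (i + 1)
             then \<exists>c. snd (xs ! i) = Some c \<and> 1 \<le> c \<and> c \<le> fst (xs ! i)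
             else snd (xs ! i) = None)}"

end

theory Submission
  imports Defs
begin

text \<open>
  A colouring of \<open>p \<ge> 2\<close> avoiding colour 2 has \<open>p - 1\<close> colours to choose from, so it amounts to a
  splitting \<open>p = u + c\<close> with \<open>u, c \<ge> 1\<close>; a part 1 has only one colour. Hence a restricted
  composition is a sequence of blocks \<open>1\<^sup>j (u + c)\<close> followed by \<open>1\<^sup>m\<close>, with \<open>j, m \<ge> 0\<close>. Such a
  block corresponds to an uncoloured part \<open>u\<close> followed by the part \<open>c + j\<close> of colour \<open>c\<close>, and
  \<open>1\<^sup>m\<close> corresponds to a last uncoloured part \<open>m\<close>, which is absent if \<open>m = 0\<close>.
\<close>

definition restricted_compositions :: "nat \<Rightarrow> (nat \<times> nat) list set" where
  "restricted_compositions k = {xs \<in> n_color_compositions k. \<forall>(p, c) \<in> set xs. c \<noteq> 2}"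

text \<open>The first argument counts the parts 1 read since the last larger part.\<close>

fun to_even :: "nat \<Rightarrow> (nat \<times> nat) list \<Rightarrow> (nat \<times> nat option) list" where
  "to_even m [] = (if m = 0 then [] else [(m, None)])"
| "to_even m ((p, c) # xs) =
     (if p = 1 then to_even (Suc m) xs
      else let u = (if c = 1 then 1 else c - 1)
           in (u, None) # (p - u + m, Some (p - u)) # to_even 0 xs)"

text \<open>The colour \<open>if u = 1 then 1 else u + 1\<close> numbers the allowed colours 1, 3,
  4, ... by \<open>u\<close> = 1, 2, 3, ...; it inverts the choice of \<open>u\<close> in
  \<open>to_even\<close>.\<close>

fun of_even :: "(nat \<times> nat option) list \<Rightarrow> (nat \<times> nat) list" where
  "of_even [] = []"
| "of_even [(u, _)] = replicate u (1, 1)"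
| "of_even ((u, _) # (p, c) # ys) =
     replicate (p - the c) (1, 1) @ (u + the c, if u = 1 then 1 else u + 1) # of_even ys"

lemma restricted_compositions_Nil [simp]: "[] \<in> restricted_compositions k \<longleftrightarrow> k = 0"
  by (auto simp: restricted_compositions_def n_color_compositions_def compositions_def)

lemma restricted_compositions_Cons [simp]:
  "(p, c) # xs \<in> restricted_compositions k \<longleftrightarrow>
     1 \<le> c \<and> c \<le> p \<and> c \<noteq> 2 \<and> p \<le> k \<and> xs \<in> restricted_compositions (k - p)"
  by (auto simp: restricted_compositions_def n_color_compositions_def compositions_def)

lemma restricted_compositions_replicate [simp]:
  "replicate n (Suc 0, Suc 0) @ xs \<in> restricted_compositions k \<longleftrightarrow>
     n \<le> k \<and> xs \<in> restricted_compositions (k - n)"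
proof (induction n arbitrary: k)
  case (Suc n)
  show ?case by (cases k) (simp_all add: Suc)
qed simp

lemma even_colored_compositions_Nil [simp]: "[] \<in> even_colored_compositions k \<longleftrightarrow> k = 0"
  by (auto simp: even_colored_compositions_def compositions_def)

lemma even_colored_compositions_single [simp]:
  "[(u, a)] \<in> even_colored_compositions k \<longleftrightarrow> a = None \<and> 1 \<le> u \<and> u = k"
  by (auto simp: even_colored_compositions_def compositions_def)

text \<open>Removing two entries keeps the parity of every later position, so the tail meets the
  same condition.\<close>

lemma even_colored_compositions_Cons_Cons [simp]:
  "(u, a) # (p, b) # ys \<in> even_colored_compositions k \<longleftrightarrow>
     a = None \<and> 1 \<le> u \<and> (\<exists>c. b = Some c \<and> 1 \<le> c \<and> c \<le> p) \<and> u + p \<le> k \<and>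
     ys \<in> even_colored_compositions (k - (u + p))"
  by (auto simp: even_colored_compositions_def compositions_def All_less_Suc2)

text \<open>The \<open>m\<close> pending ones still count towards the total. A larger part gives
  \<open>u + (p - u + m) = p + m\<close>, with \<open>1 \<le> u\<close> and \<open>u < p\<close>
  because \<open>c \<noteq> 2\<close>.\<close>

lemma to_even_mem:
  "xs \<in> restricted_compositions k \<Longrightarrow> to_even m xs \<in> even_colored_compositions (m + k)"
proof (induction m xs arbitrary: k rule: to_even.induct)
  case (2 m p c xs)
  show ?case
  proof (cases "p = 1")
    case True
    then show ?thesis using "2.IH"(1)[of "k - 1"] "2.prems" by auto
  next
    case False
    then show ?thesis using "2.IH"(2)[OF False refl, of "k - p"] "2.prems" by (auto simp: Let_def)
  qed
qed auto

lemma of_even_mem: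
  "ys \<in> even_colored_compositions k \<Longrightarrow> of_even ys \<in> restricted_compositions k"
proof (induction ys arbitrary: k rule: of_even.induct)
  case (2 u a)
  \<comment> \<open>Appending \<open>[]\<close> gives the final run of ones the shape of the
    rule.\<close>
  then show ?case using restricted_compositions_replicate[of u "[]" k] by simp
next
  case (3 u a p b ys)
  then obtain c where "b = Some c" "1 \<le> u" "1 \<le> c" "c \<le> p" "u + p \<le> k"
    "of_even ys \<in> restricted_compositions (k - (u + p))"
    by auto
  then show ?case by (auto simp: algebra_simps)
qed auto

lemma of_even_to_even:
  "xs \<in> restricted_compositions k \<Longrightarrow> of_even (to_even m xs) = replicate m (1, 1) @ xs"
proof (induction m xs arbitrary: k rule: to_even.induct)
  case (2 m p c xs)
  show ?case
  proof (cases "p = 1")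
    case True
    then show ?thesis
      using "2.IH"(1)[of "k - 1"] "2.prems" by (auto simp: replicate_app_Cons_same)
  next
    case False
    then show ?thesis using "2.IH"(2)[OF False refl, of "k - p"] "2.prems" by (auto simp: Let_def)
  qed
qed auto

text \<open>The counter absorbs the ones that \<open>of_even\<close> places before a larger
  part.\<close>

lemma to_even_replicate [simp]: "to_even m (replicate n (Suc 0, Suc 0) @ xs) = to_even (m + n) xs"
  by (induction n arbitrary: m) auto

lemma to_even_of_even:
  "ys \<in> even_colored_compositions k \<Longrightarrow> to_even 0 (of_even ys) = ys"
proof (induction ys arbitrary: k rule: of_even.induct)
  case (2 u a)
  then show ?case using to_even_replicate[of 0 u "[]"] by simp
next
  case (3 u a p b ys)
  then obtain c where "a = None" "b = Some c" "1 \<le> u" "1 \<le> c" "c \<le> p"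
    "to_even 0 (of_even ys) = ys"
    by auto
  \<comment> \<open>Here \<open>u + c \<ge> 2\<close>, so the part is read as a larger one; the
    \<open>p - c\<close> counted ones restore the size \<open>c + (p - c) = p\<close>.\<close>
  then show ?case by (simp add: Let_def)
qed auto

theorem theorem3p1:
  fixes k :: nat
  assumes "k \<ge> 1"
  shows "card {xs \<in> n_color_compositions k. \<forall>(p, c) \<in> set xs. c \<noteq> 2}
       = card (even_colored_compositions k)"
proof -
  have "bij_betw (to_even 0) (restricted_compositions k) (even_colored_compositions k)"
    using to_even_mem[of _ k 0] of_even_mem[of _ k] of_even_to_even[of _ k 0] to_even_of_even[of _ k]
    by (intro bij_betw_byWitness[where f' = of_even]) auto
  then show ?thesis
    unfolding restricted_compositions_def by (rule bij_betw_same_card)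
qed

end
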